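(* Let $\Gamma_1$ and $\Gamma_2$ be directed graphs, $\Gamma_j=(r,s\colon E_j\rightrightarrows V_j)$, and let $R\colon\Gamma_1\to\Gamma_2$ be an admissible relation morphism. For each $v\in V_2$, set $\Omega_v:=\bigcup_{u\in R^{-1}(v)}Z_u$, and for each $f\in E_2$, set $T_f:=\bigcup_{x\in R^{-1}(f)}Z(x,s(x))$. The families $(\Omega_v)_{v\in V_2}$ and $(T_f)_{f\in E_2}$ form a possibly degenerate dynamical Cuntz–Krieger $\Gamma_2$-family in the boundary path groupoid $G_{\Gamma_1}$. This dynamical Cuntz–Krieger family is nondegenerate if and only if $R^{-1}(V_2)=V_1$. In addition, (1) for all $u\in V_1$ and $v\in V_2$, either $Z_u\Omega_v=\emptyset$ or $Z_u\Omega_v=Z_u$; (2) for all $u\in V_1$ and $f\in E_2$, either $T_fZ_u=\emptyset$ or there is a finite path $x\in FP(\Gamma_1)$ such that $T_fZ_u=Z(x,s(x))$.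
   Context: Graphs: $\Gamma=(r,s\colon E\rightrightarrows V)$ is a directed graph; a vertex $v$ is regular if $r^{-1}(v)$ is finite and nonempty. Paths are words $e_1e_2\cdots$ of edges with $s(e_i)=r(e_{i+1})$; vertices are paths of length $0$; $|x|$ is the length. $FP(\Gamma)$ is the set of finite paths, with $r(e_1\cdots e_n)=r(e_1)$, $s(e_1\cdots e_n)=s(e_n)$. For $x,x'\in FP(\Gamma)$, $x\preceq x'$ means $x'=xy$ for some $y\in FP(\Gamma)$; $x\sim x'$ means $x\preceq x'$ or $x'\preceq x$. Boundary path groupoid: $\partial\Gamma$ consists of all infinite paths and all finite paths $x$ (including vertices) with $s(x)$ not regular. For $x,y\in FP(\Gamma)$ with $s(x)=s(y)$, $Z_x=\{z\in\partial\Gamma:z=xz'\text{ for some }z'\in\partial\Gamma\}$ and $Z(x,y)=\{(xz,|x|-|y|,yz):z\in\partial\Gamma,\ r(z)=s(x)\}$. The sets $Z_x\setminus\bigcup_{e\in F}Z_{xe}$ with $F\subseteq r^{-1}(s(x))$ finite form a basis of the topology of $\partial\Gamma$. $G_\Gamma$ is the union of all $Z(x,y)$, with $r(a,k,b)=a$, $s(a,k,b)=b$, $(a,k,b)(b,l,c)=(a,k+l,c)$, object space $\partial\Gamma$, and basis of topology the sets $\{(xz,|x|-|y|,yz):z\in U\}$ for $U\subseteq Z_{s(x)}$ open. It is an étale locally compact Hausdorff groupoid. Subsets of $\partial\Gamma$ are identified with sets of unit arrows, and products of subsets of $G_\Gamma$ are $AB=\{ab:a\in A,b\in B,s(a)=r(b)\}$.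 Dynamical Cuntz–Krieger $\Gamma$-family in an étale groupoid $\mathcal H$: compact-open subsets $\Omega_v\subseteq\mathcal H^0$ ($v\in V$) and bisections $T_e\subseteq\mathcal H$ ($e\in E$; open subsets on which $r$ and $s$ are injective) such that (i) $\Omega_v\cap\Omega_w=\emptyset$ for $v\ne w$; (ii) $s(T_e)=\Omega_{s(e)}$ and $r(T_e)\subseteq\Omega_{r(e)}$; (iii) $r(T_e)\cap r(T_f)=\emptyset$ for $e\ne f$; (iv) $\bigsqcup_{r(e)=v}r(T_e)=\Omega_v$ for each regular vertex $v$. It is nondegenerate if $\mathcal H^0=\bigsqcup_{v}\Omega_v$. Relation morphism $R\colon\Gamma_1\to\Gamma_2$: a relation $R\subseteq FP(\Gamma_1)\times FP(\Gamma_2)$ such that if $(x,y)\in R$ and $y\in V_2$ then $x\in V_1$; and if $(x,y)\in R$ then $(s(x),s(y))\in R$ and $(r(x),r(y))\in R$. Write $R^{-1}(y)=\{x:(x,y)\in R\}$ and $R^{-1}(V_2)=\bigcup_{v\in V_2}R^{-1}(v)$. It is admissible if it is: (a) multiplicative: if $(x,y),(x',y')\in R$, $s(x)=r(x')$, $s(y)=r(y')$, then $(xx',yy')\in R$; (b) decomposable: if $y,y'\in FP(\Gamma_2)$, $s(y)=r(y')$, $(\overline x,yy')\in R$, then there are $x\in R^{-1}(y)$, $x'\in R^{-1}(y')$ with $xx'=\overline x$; (c) proper: $R^{-1}(y)$ is finite for all $y\in FP(\Gamma_2)$; (d) vertex disjoint: $R^{-1}(v)\cap R^{-1}(v')=\emptyset$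 for all $v\ne v'$ in $V_2$; (e) source bijective: $s\colon R^{-1}(f)\to R^{-1}(s(f))$ is bijective for all $f\in E_2$; (f) monotone: if $(x,f),(x',f')\in R$ with $f,f'\in E_2$ and $x\preceq x'$, then $(x,f)=(x',f')$; (g) regular: if $v\in V_2$ is regular, $u\in R^{-1}(v)$ and $x\in FP(\Gamma_1)$ with $r(x)=u$, then there is $(x',f)\in R$ with $f\in E_2$, $r(f)=v$ and $x\sim x'$. *)

theory Defs
  imports "HOL-Analysis.Analysis" "HOL-Library.Stream" "Graph_Theory.Digraph"
begin

text \<open>
  A directed graph \<open>(r, s : E \<rightrightarrows> V)\<close> is a \<open>wf_digraph\<close> with \<open>r = head\<close> and \<open>s = tail\<close>; vertices
  and edges may be arbitrary sets.
\<close>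

definition regular_vertex :: "('v, 'e) pre_digraph \<Rightarrow> 'v \<Rightarrow> bool" where
  "regular_vertex \<Gamma> v \<longleftrightarrow> v \<in> verts \<Gamma> \<and> finite (in_arcs \<Gamma> v) \<and> in_arcs \<Gamma> v \<noteq> {}"


section \<open>Paths\<close>

text \<open>
  A finite path \<open>e\<^sub>1 \<dots> e\<^sub>n\<close> is stored as its range together with the word \<open>[e\<^sub>1, \<dots>, e\<^sub>n]\<close>, so that
  the vertex \<open>v\<close>, a path of length \<open>0\<close>, is \<open>(v, [])\<close>. Consecutive edges satisfy
  \<open>s(e\<^sub>i) = r(e\<^sub>i\<^sub>+\<^sub>1)\<close>, which is the reverse of the order in \<open>awalk\<close> of Graph_Theory.
\<close>

type_synonym ('v, 'e) fpath = "'v \<times> 'e list"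

fun is_word_from :: "('v, 'e) pre_digraph \<Rightarrow> 'v \<Rightarrow> 'e list \<Rightarrow> bool" where
  "is_word_from \<Gamma> v [] \<longleftrightarrow> v \<in> verts \<Gamma>"
| "is_word_from \<Gamma> v (e # es) \<longleftrightarrow> e \<in> arcs \<Gamma> \<and> head \<Gamma> e = v \<and> is_word_from \<Gamma> (tail \<Gamma> e) es"

definition FP :: "('v, 'e) pre_digraph \<Rightarrow> ('v, 'e) fpath set" where
  "FP \<Gamma> = {(v, es). is_word_from \<Gamma> v es}"

definition vpath :: "'v \<Rightarrow> ('v, 'e) fpath" where
  "vpath v = (v, [])"

definition epath :: "('v, 'e) pre_digraph \<Rightarrow> 'e \<Rightarrow> ('v, 'e) fpath" where
  "epath \<Gamma> e = (head \<Gamma> e, [e])"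

definition prng :: "('v, 'e) fpath \<Rightarrow> 'v" where
  "prng x = fst x"

definition psrc :: "('v, 'e) pre_digraph \<Rightarrow> ('v, 'e) fpath \<Rightarrow> 'v" where
  "psrc \<Gamma> x = (if snd x = [] then fst x else tail \<Gamma> (last (snd x)))"

definition plen :: "('v, 'e) fpath \<Rightarrow> nat" where
  "plen x = length (snd x)"

text \<open>\<open>pconc x y\<close> is the product \<open>xy\<close>; it is meaningful only if \<open>s(x) = r(y)\<close>.\<close>

definition pconc :: "('v, 'e) fpath \<Rightarrow> ('v, 'e) fpath \<Rightarrow> ('v, 'e) fpath" where
  "pconc x y = (fst x, snd x @ snd y)"

definition path_le :: "('v, 'e) pre_digraph \<Rightarrow> ('v, 'e) fpath \<Rightarrow> ('v, 'e) fpath \<Rightarrow> bool" where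
  "path_le \<Gamma> x x' \<longleftrightarrow> (\<exists>y\<in>FP \<Gamma>. psrc \<Gamma> x = prng y \<and> x' = pconc x y)"

definition path_comparable :: "('v, 'e) pre_digraph \<Rightarrow> ('v, 'e) fpath \<Rightarrow> ('v, 'e) fpath \<Rightarrow> bool" where
  "path_comparable \<Gamma> x x' \<longleftrightarrow> path_le \<Gamma> x x' \<or> path_le \<Gamma> x' x"

definition infinite_paths :: "('v, 'e) pre_digraph \<Rightarrow> 'e stream set" where
  "infinite_paths \<Gamma> =
     {es. \<forall>i. es !! i \<in> arcs \<Gamma> \<and> tail \<Gamma> (es !! i) = head \<Gamma> (es !! Suc i)}"


section \<open>The boundary path space\<close>

datatype ('v, 'e) bpath = Fin "('v, 'e) fpath" | Inf "'e stream"

definition boundary :: "('v, 'e) pre_digraph \<Rightarrow> ('v, 'e) bpath set" where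
  "boundary \<Gamma> =
     Fin ` {x \<in> FP \<Gamma>. \<not> regular_vertex \<Gamma> (psrc \<Gamma> x)} \<union> Inf ` infinite_paths \<Gamma>"

fun brng :: "('v, 'e) pre_digraph \<Rightarrow> ('v, 'e) bpath \<Rightarrow> 'v" where
  "brng \<Gamma> (Fin x) = prng x"
| "brng \<Gamma> (Inf es) = head \<Gamma> (shd es)"

text \<open>\<open>bconc x z\<close> is the product \<open>xz\<close>; it is meaningful only if \<open>s(x) = r(z)\<close>.\<close>

fun bconc :: "('v, 'e) fpath \<Rightarrow> ('v, 'e) bpath \<Rightarrow> ('v, 'e) bpath" where
  "bconc x (Fin y) = Fin (pconc x y)"
| "bconc x (Inf es) = Inf (snd x @- es)"

definition cyl :: "('v, 'e) pre_digraph \<Rightarrow> ('v, 'e) fpath \<Rightarrow> ('v, 'e) bpath set" where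
  "cyl \<Gamma> x = {z \<in> boundary \<Gamma>. \<exists>z'\<in>boundary \<Gamma>. psrc \<Gamma> x = brng \<Gamma> z' \<and> z = bconc x z'}"

text \<open>
  The sets listed in the next two topologies form a base (any two of them meet in a union of
  others), so the generated topology is the one having them as a base.
\<close>

definition boundary_topology :: "('v, 'e) pre_digraph \<Rightarrow> ('v, 'e) bpath topology" where
  "boundary_topology \<Gamma> = topology_generated_by
     {cyl \<Gamma> x - (\<Union>e\<in>F. cyl \<Gamma> (pconc x (epath \<Gamma> e))) | x F.
        x \<in> FP \<Gamma> \<and> F \<subseteq> in_arcs \<Gamma> (psrc \<Gamma> x) \<and> finite F}"

type_synonym ('v, 'e) barrow = "('v, 'e) bpath \<times> int \<times> ('v, 'e) bpath"

definition arrow_set ::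
    "('v, 'e) fpath \<Rightarrow> ('v, 'e) fpath \<Rightarrow> ('v, 'e) bpath set \<Rightarrow> ('v, 'e) barrow set" where
  "arrow_set x y U = {(bconc x z, int (plen x) - int (plen y), bconc y z) | z. z \<in> U}"

definition Zarr ::
    "('v, 'e) pre_digraph \<Rightarrow> ('v, 'e) fpath \<Rightarrow> ('v, 'e) fpath \<Rightarrow> ('v, 'e) barrow set" where
  "Zarr \<Gamma> x y = arrow_set x y {z \<in> boundary \<Gamma>. brng \<Gamma> z = psrc \<Gamma> x}"

text \<open>The topological space of \<open>boundary_arrow_topology\<close> is the union of all \<open>Zarr \<Gamma> x y\<close>.\<close>

definition boundary_arrow_topology :: "('v, 'e) pre_digraph \<Rightarrow> ('v, 'e) barrow topology" where
  "boundary_arrow_topology \<Gamma> = topology_generated_by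
     {arrow_set x y U | x y U. x \<in> FP \<Gamma> \<and> y \<in> FP \<Gamma> \<and> psrc \<Gamma> x = psrc \<Gamma> y \<and>
        openin (boundary_topology \<Gamma>) U \<and> U \<subseteq> cyl \<Gamma> (vpath (psrc \<Gamma> x))}"


section \<open>Topological groupoids\<close>

text \<open>
  The structure of a topological groupoid: spaces of objects and arrows, range, source, unit map
  and multiplication (relevant only for \<open>gsrc g = grng h\<close>). Inverses are determined by these data.
\<close>

record ('o, 'g) topological_groupoid =
  gobj :: "'o topology"
  garr :: "'g topology"
  grng :: "'g \<Rightarrow> 'o"
  gsrc :: "'g \<Rightarrow> 'o"
  gunit :: "'o \<Rightarrow> 'g"
  gmult :: "'g \<Rightarrow> 'g \<Rightarrow> 'g"

definition gset_mult :: "('o, 'g) topological_groupoid \<Rightarrow> 'g set \<Rightarrow> 'g set \<Rightarrow> 'g set" where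
  "gset_mult H A B = {gmult H a b | a b. a \<in> A \<and> b \<in> B \<and> gsrc H a = grng H b}"

definition bisection :: "('o, 'g) topological_groupoid \<Rightarrow> 'g set \<Rightarrow> bool" where
  "bisection H T \<longleftrightarrow> openin (garr H) T \<and> inj_on (grng H) T \<and> inj_on (gsrc H) T"

definition boundary_groupoid ::
    "('v, 'e) pre_digraph \<Rightarrow> (('v, 'e) bpath, ('v, 'e) barrow) topological_groupoid" where
  "boundary_groupoid \<Gamma> =
     \<lparr>gobj = boundary_topology \<Gamma>,
      garr = boundary_arrow_topology \<Gamma>,
      grng = (\<lambda>(a, k, b). a),
      gsrc = (\<lambda>(a, k, b). b),
      gunit = (\<lambda>a. (a, 0, a)),
      gmult = (\<lambda>(a, k, b) (b', l, c). (a, k + l, c))\<rparr>"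


section \<open>Dynamical Cuntz--Krieger families\<close>

text \<open>Not assumed to be nondegenerate.\<close>

definition dynamical_CK_family ::
    "('v, 'e) pre_digraph \<Rightarrow> ('o, 'g) topological_groupoid \<Rightarrow>
     ('v \<Rightarrow> 'o set) \<Rightarrow> ('e \<Rightarrow> 'g set) \<Rightarrow> bool" where
  "dynamical_CK_family \<Gamma> H \<Omega> T \<longleftrightarrow>
     (\<forall>v\<in>verts \<Gamma>. openin (gobj H) (\<Omega> v) \<and> compactin (gobj H) (\<Omega> v)) \<and>
     (\<forall>e\<in>arcs \<Gamma>. bisection H (T e)) \<and>
     (\<forall>v\<in>verts \<Gamma>. \<forall>w\<in>verts \<Gamma>. v \<noteq> w \<longrightarrow> \<Omega> v \<inter> \<Omega> w = {}) \<and>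
     (\<forall>e\<in>arcs \<Gamma>. gsrc H ` T e = \<Omega> (tail \<Gamma> e) \<and> grng H ` T e \<subseteq> \<Omega> (head \<Gamma> e)) \<and>
     (\<forall>e\<in>arcs \<Gamma>. \<forall>f\<in>arcs \<Gamma>. e \<noteq> f \<longrightarrow> grng H ` T e \<inter> grng H ` T f = {}) \<and>
     (\<forall>v. regular_vertex \<Gamma> v \<longrightarrow> (\<Union>e\<in>in_arcs \<Gamma> v. grng H ` T e) = \<Omega> v)"

definition nondegenerate_CK_family ::
    "('v, 'e) pre_digraph \<Rightarrow> ('o, 'g) topological_groupoid \<Rightarrow>
     ('v \<Rightarrow> 'o set) \<Rightarrow> ('e \<Rightarrow> 'g set) \<Rightarrow> bool" where
  "nondegenerate_CK_family \<Gamma> H \<Omega> T \<longleftrightarrow>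
     dynamical_CK_family \<Gamma> H \<Omega> T \<and> topspace (gobj H) = (\<Union>v\<in>verts \<Gamma>. \<Omega> v)"


section \<open>Relation morphisms\<close>

text \<open>\<open>R\<^sup>-\<^sup>1(y)\<close> is \<open>Rinv R y\<close>; vertices and edges occur in \<open>R\<close> as the paths \<open>vpath v\<close>, \<open>epath \<Gamma> e\<close>.\<close>

definition Rinv :: "('a \<times> 'b) set \<Rightarrow> 'b \<Rightarrow> 'a set" where
  "Rinv R y = {x. (x, y) \<in> R}"

definition relation_morphism ::
    "('v, 'e) pre_digraph \<Rightarrow> ('w, 'f) pre_digraph \<Rightarrow>
     (('v, 'e) fpath \<times> ('w, 'f) fpath) set \<Rightarrow> bool" where
  "relation_morphism \<Gamma> \<Gamma>' R \<longleftrightarrow>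
     R \<subseteq> FP \<Gamma> \<times> FP \<Gamma>' \<and>
     (\<forall>x y. (x, y) \<in> R \<and> y \<in> vpath ` verts \<Gamma>' \<longrightarrow> x \<in> vpath ` verts \<Gamma>) \<and>
     (\<forall>x y. (x, y) \<in> R \<longrightarrow>
        (vpath (psrc \<Gamma> x), vpath (psrc \<Gamma>' y)) \<in> R \<and> (vpath (prng x), vpath (prng y)) \<in> R)"

definition rel_multiplicative where
  "rel_multiplicative \<Gamma> \<Gamma>' R \<longleftrightarrow>
     (\<forall>x y x' y'. (x, y) \<in> R \<and> (x', y') \<in> R \<and> psrc \<Gamma> x = prng x' \<and> psrc \<Gamma>' y = prng y' \<longrightarrow>
        (pconc x x', pconc y y') \<in> R)"

definition rel_decomposable where
  "rel_decomposable \<Gamma> \<Gamma>' R \<longleftrightarrow>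
     (\<forall>y\<in>FP \<Gamma>'. \<forall>y'\<in>FP \<Gamma>'. \<forall>xx. psrc \<Gamma>' y = prng y' \<and> (xx, pconc y y') \<in> R \<longrightarrow>
        (\<exists>x\<in>Rinv R y. \<exists>x'\<in>Rinv R y'. psrc \<Gamma> x = prng x' \<and> pconc x x' = xx))"

definition rel_proper where
  "rel_proper \<Gamma>' R \<longleftrightarrow> (\<forall>y\<in>FP \<Gamma>'. finite (Rinv R y))"

definition rel_vertex_disjoint where
  "rel_vertex_disjoint \<Gamma>' R \<longleftrightarrow>
     (\<forall>v\<in>verts \<Gamma>'. \<forall>v'\<in>verts \<Gamma>'. v \<noteq> v' \<longrightarrow> Rinv R (vpath v) \<inter> Rinv R (vpath v') = {})"

definition rel_source_bijective where
  "rel_source_bijective \<Gamma> \<Gamma>' R \<longleftrightarrow>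
     (\<forall>f\<in>arcs \<Gamma>'. bij_betw (\<lambda>x. vpath (psrc \<Gamma> x))
        (Rinv R (epath \<Gamma>' f)) (Rinv R (vpath (tail \<Gamma>' f))))"

definition rel_monotone where
  "rel_monotone \<Gamma> \<Gamma>' R \<longleftrightarrow>
     (\<forall>x x'. \<forall>f\<in>arcs \<Gamma>'. \<forall>f'\<in>arcs \<Gamma>'.
        (x, epath \<Gamma>' f) \<in> R \<and> (x', epath \<Gamma>' f') \<in> R \<and> path_le \<Gamma> x x' \<longrightarrow> (x, f) = (x', f'))"

definition rel_regular where
  "rel_regular \<Gamma> \<Gamma>' R \<longleftrightarrow>
     (\<forall>v u. \<forall>x\<in>FP \<Gamma>. regular_vertex \<Gamma>' v \<and> vpath u \<in> Rinv R (vpath v) \<and> prng x = u \<longrightarrow>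
        (\<exists>x' f. (x', epath \<Gamma>' f) \<in> R \<and> f \<in> arcs \<Gamma>' \<and> head \<Gamma>' f = v \<and> path_comparable \<Gamma> x x'))"

definition admissible_relation_morphism ::
    "('v, 'e) pre_digraph \<Rightarrow> ('w, 'f) pre_digraph \<Rightarrow>
     (('v, 'e) fpath \<times> ('w, 'f) fpath) set \<Rightarrow> bool" where
  "admissible_relation_morphism \<Gamma> \<Gamma>' R \<longleftrightarrow>
     relation_morphism \<Gamma> \<Gamma>' R \<and>
     rel_multiplicative \<Gamma> \<Gamma>' R \<and> rel_decomposable \<Gamma> \<Gamma>' R \<and> rel_proper \<Gamma>' R \<and>
     rel_vertex_disjoint \<Gamma>' R \<and> rel_source_bijective \<Gamma> \<Gamma>' R \<and>
     rel_monotone \<Gamma> \<Gamma>' R \<and> rel_regular \<Gamma> \<Gamma>' R"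

definition rel_Omega ::
    "('v, 'e) pre_digraph \<Rightarrow> (('v, 'e) fpath \<times> ('w, 'f) fpath) set \<Rightarrow>
     'w \<Rightarrow> ('v, 'e) bpath set" where
  "rel_Omega \<Gamma> R v = (\<Union>u\<in>Rinv R (vpath v). cyl \<Gamma> u)"

definition rel_T ::
    "('v, 'e) pre_digraph \<Rightarrow> ('w, 'f) pre_digraph \<Rightarrow>
     (('v, 'e) fpath \<times> ('w, 'f) fpath) set \<Rightarrow> 'f \<Rightarrow> ('v, 'e) barrow set" where
  "rel_T \<Gamma> \<Gamma>' R f = (\<Union>x\<in>Rinv R (epath \<Gamma>' f). Zarr \<Gamma> x (vpath (psrc \<Gamma> x)))"

end

theory Submission
  imports Defs "HOL-Library.Sublist"
begin

text \<open>
  Everything rests on reading \<open>z \<in> cyl \<Gamma> x\<close> as "\<open>x\<close> is a prefix of the boundary path \<open>z\<close>". Two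
  prefixes of one boundary path are nested (lemma \<open>cyl_meet_comparable\<close>), so set-theoretic
  questions about cylinders become questions about the prefix order, to which the axioms of an
  admissible relation morphism speak directly:

  \<^item> Monotonicity makes the paths related to edges of the second graph an antichain; therefore their
    cylinders, the ranges of the pieces of the \<open>T\<^sub>f\<close>, are pairwise disjoint
    (\<open>R_edge_cyl_unique\<close>). This gives injectivity of the range map on \<open>T\<^sub>f\<close> and the
    orthogonality of the ranges of \<open>T\<^sub>e\<close> and \<open>T\<^sub>f\<close> for \<open>e \<noteq> f\<close>.
  \<^item> Source bijectivity gives injectivity of the source map on \<open>T\<^sub>f\<close>, the equality of its source with
    \<open>\<Omega>\<^sub>s\<^sub>(\<^sub>f\<^sub>)\<close>, and the fact that cutting \<open>T\<^sub>f\<close> down to \<open>Z\<^sub>u\<close> on the right leaves at most one piece.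
  \<^item> Vertex disjointness gives the disjointness of the \<open>\<Omega>\<^sub>v\<close>, since a boundary path lies in \<open>\<Omega>\<^sub>v\<close>
    exactly if its range is related to \<open>v\<close> (\<open>rel_Omega_iff\<close>).
  \<^item> Properness makes \<open>\<Omega>\<^sub>v\<close> a finite union of cylinders, and cylinders are compact and open
    (\<open>compactin_cyl\<close>, \<open>openin_cyl\<close>).
  \<^item> Regularity says that every finite path out of \<open>R\<inverse>(v)\<close>, for \<open>v\<close> regular, is comparable to
    a path related to an edge with range \<open>v\<close>. There are only finitely many of the latter, so
    that sufficiently long prefixes of a boundary path have one of them as a prefix; a
    counting argument handles boundary paths that are too short (\<open>rel_Omega_regular\<close>).

  The topological input is the compactness of cylinders. It is a form of Koenig's lemma: a cylinder
  without a finite subcover would have a one-edge extension with the same defect, and so on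
  along an infinite path, contradicting openness at the limit. The same device shows that
  cylinders are not empty, which is needed for the characterization of nondegeneracy.
\<close>

section \<open>Paths and their prefixes\<close>

lemma plen_pconc [simp]: "plen (pconc x y) = plen x + plen y"
  by (simp add: plen_def pconc_def)

lemma prng_pconc [simp]: "prng (pconc x y) = prng x"
  by (simp add: prng_def pconc_def)

lemma psrc_vpath [simp]: "psrc \<Gamma> (vpath v) = v"
  by (simp add: psrc_def vpath_def)

lemma prng_vpath [simp]: "prng (vpath v) = v"
  by (simp add: prng_def vpath_def)

lemma plen_vpath [simp]: "plen (vpath v) = 0"
  by (simp add: plen_def vpath_def)

lemma psrc_epath [simp]: "psrc \<Gamma> (epath \<Gamma> e) = tail \<Gamma> e"
  by (simp add: psrc_def epath_def)

lemma prng_epath [simp]: "prng (epath \<Gamma> e) = head \<Gamma> e"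
  by (simp add: prng_def epath_def)

lemma psrc_pconc: "psrc \<Gamma> x = prng y \<Longrightarrow> psrc \<Gamma> (pconc x y) = psrc \<Gamma> y"
  by (auto simp: psrc_def pconc_def prng_def)

lemma pconc_assoc: "pconc (pconc x y) z = pconc x (pconc y z)"
  by (simp add: pconc_def)

lemma bconc_pconc: "bconc (pconc x y) z = bconc x (bconc y z)"
  by (cases z) (simp_all add: pconc_assoc pconc_def)

lemma bconc_vpath [simp]: "brng \<Gamma> z = v \<Longrightarrow> bconc (vpath v) z = z"
  by (cases z) (auto simp: vpath_def pconc_def prng_def)

lemma bconc_left_cancel: "bconc x z = bconc x z' \<Longrightarrow> brng \<Gamma> z = brng \<Gamma> z' \<Longrightarrow> z = z'"
  by (cases z; cases z') (auto simp: pconc_def prng_def prod_eq_iff)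

lemma plen_epath [simp]: "plen (epath \<Gamma> e) = 1"
  by (simp add: plen_def epath_def)

context wf_digraph
begin

lemma is_word_from_verts: "is_word_from G v es \<Longrightarrow> v \<in> verts G"
  by (cases es) auto

lemma is_word_from_append:
  "is_word_from G v (es @ fs) \<longleftrightarrow> is_word_from G v es \<and> is_word_from G (psrc G (v, es)) fs"
proof (induction es arbitrary: v)
  case Nil
  then show ?case by (auto simp: psrc_def is_word_from_verts)
next
  case (Cons e es)
  have "psrc G (tail G e, es) = psrc G (v, e # es)" by (simp add: psrc_def)
  with Cons show ?case by auto
qed

lemma prng_verts: "x \<in> FP G \<Longrightarrow> prng x \<in> verts G"
  by (auto simp: FP_def prng_def is_word_from_verts)

lemma psrc_verts:
  assumes "x \<in> FP G" shows "psrc G x \<in> verts G"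
proof -
  obtain v es where x: "x = (v, es)" by (cases x)
  have "is_word_from G v (es @ [])" using assms x by (simp add: FP_def)
  then show ?thesis unfolding is_word_from_append x by simp
qed

lemma vpath_in_FP [simp]: "vpath v \<in> FP G \<longleftrightarrow> v \<in> verts G"
  by (simp add: FP_def vpath_def)

lemma epath_in_FP [simp]: "epath G e \<in> FP G \<longleftrightarrow> e \<in> arcs G"
  by (auto simp: FP_def epath_def)

lemma pconc_in_FP:
  "x \<in> FP G \<Longrightarrow> psrc G x = prng y \<Longrightarrow> pconc x y \<in> FP G \<longleftrightarrow> y \<in> FP G"
  by (cases x; cases y) (auto simp: FP_def pconc_def prng_def is_word_from_append)

lemma pconc_epath_in_FP:
  "x \<in> FP G \<Longrightarrow> e \<in> in_arcs G (psrc G x) \<Longrightarrow> pconc x (epath G e) \<in> FP G"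
  by (simp add: pconc_in_FP)

lemma path_le_iff_prefix:
  assumes "x \<in> FP G" "y \<in> FP G"
  shows "path_le G x y \<longleftrightarrow> prng x = prng y \<and> prefix (snd x) (snd y)"
proof
  assume "path_le G x y"
  then show "prng x = prng y \<and> prefix (snd x) (snd y)"
    by (auto simp: path_le_def pconc_def prng_def)
next
  assume *: "prng x = prng y \<and> prefix (snd x) (snd y)"
  then obtain w where w: "snd y = snd x @ w" by (auto simp: prefix_def)
  have y: "y = pconc x (psrc G x, w)"
    using * w by (simp add: pconc_def prng_def prod_eq_iff)
  moreover have "(psrc G x, w) \<in> FP G"
    using assms y by (simp add: pconc_in_FP prng_def)
  ultimately show "path_le G x y" unfolding path_le_def
    by (intro bexI[of _ "(psrc G x, w)"]) (auto simp: prng_def)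
qed

lemma path_le_imp_prefix: "path_le G x y \<Longrightarrow> prefix (snd x) (snd y)"
  by (auto simp: path_le_def pconc_def)

lemma path_le_refl: "x \<in> FP G \<Longrightarrow> path_le G x x"
  by (simp add: path_le_iff_prefix)

lemma path_le_pconc_epath:
  assumes "x \<in> FP G" "e \<in> in_arcs G (psrc G x)"
  shows "path_le G x (pconc x (epath G e))"
  using assms unfolding path_le_def by (intro bexI[of _ "epath G e"]) auto

lemma path_le_first_edge:
  assumes "x \<in> FP G" "y \<in> FP G" "path_le G x y" "plen x < plen y"
  obtains e where "e \<in> in_arcs G (psrc G x)" "path_le G (pconc x (epath G e)) y"
proof -
  obtain w where w: "w \<in> FP G" "psrc G x = prng w" "y = pconc x w"
    using assms by (auto simp: path_le_def)
  then obtain e es where e: "snd w = e # es"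
    using assms(4) by (cases "snd w") (auto simp: plen_def pconc_def)
  have in_arcs: "e \<in> in_arcs G (psrc G x)"
    using w e by (cases w) (auto simp: FP_def prng_def)
  have "path_le G (pconc x (epath G e)) y"
    using assms in_arcs w e
    by (simp add: path_le_iff_prefix pconc_epath_in_FP) (simp add: pconc_def epath_def)
  with in_arcs show ?thesis by (rule that)
qed

section \<open>Cylinder sets\<close>

lemma infinite_path_prefix_in_FP:
  assumes "es \<in> infinite_paths G"
  shows "(head G (shd es), stake n es) \<in> FP G"
  using assms
proof (induction n arbitrary: es)
  case 0
  then have "shd es \<in> arcs G" by (auto simp: infinite_paths_def dest: spec[of _ 0])
  then show ?case by (simp add: FP_def)
next
  case (Suc n)
  have "stl es \<in> infinite_paths G" using Suc.prems
    unfolding infinite_paths_def by (auto dest: spec[of _ "Suc _"])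
  moreover have "shd es \<in> arcs G" "tail G (shd es) = head G (shd (stl es))"
    using Suc.prems unfolding infinite_paths_def by (auto dest: spec[of _ 0])
  ultimately show ?case using Suc.IH[of "stl es"] by (simp add: FP_def)
qed

lemma Cons_in_infinite_paths:
  "e ## es \<in> infinite_paths G \<longleftrightarrow>
     e \<in> arcs G \<and> tail G e = head G (shd es) \<and> es \<in> infinite_paths G"
  (is "?L \<longleftrightarrow> ?R")
proof
  assume ?L
  then have *: "(e ## es) !! i \<in> arcs G \<and> tail G ((e ## es) !! i) = head G ((e ## es) !! Suc i)"
    for i by (auto simp: infinite_paths_def)
  from *[of 0] *[of "Suc _"] show ?R by (auto simp: infinite_paths_def)
next
  assume R: ?R
  show ?L unfolding infinite_paths_def
  proof (intro CollectI allI)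
    fix i show "(e ## es) !! i \<in> arcs G \<and> tail G ((e ## es) !! i) = head G ((e ## es) !! Suc i)"
      using R by (cases i) (auto simp: infinite_paths_def)
  qed
qed

lemma shift_in_infinite_paths:
  assumes "is_word_from G v w" "psrc G (v, w) = head G (shd es)"
  shows "w @- es \<in> infinite_paths G \<longleftrightarrow> es \<in> infinite_paths G"
    and "head G (shd (w @- es)) = v"
  using assms
proof (induction w arbitrary: v)
  case Nil
  case 1 then show ?case by simp
  case 2 then show ?case by (simp add: psrc_def)
next
  case (Cons e w)
  { case 1
    have w: "is_word_from G (tail G e) w" "psrc G (tail G e, w) = head G (shd es)"
      using 1 by (simp_all add: psrc_def split: if_splits)
    with 1 show ?case using Cons.IH(1)[OF w] Cons.IH(2)[OF w]
      unfolding shift.simps Cons_in_infinite_paths by (metis is_word_from.simps(2)) }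
  { case 2 then show ?case by simp }
qed

lemma Fin_in_boundary_iff: "Fin x \<in> boundary G \<longleftrightarrow> x \<in> FP G \<and> \<not> regular_vertex G (psrc G x)"
  by (auto simp: boundary_def)

lemma bconc_in_boundary:
  assumes "x \<in> FP G" "psrc G x = brng G z"
  shows "bconc x z \<in> boundary G \<longleftrightarrow> z \<in> boundary G"
proof (cases z)
  case (Fin y)
  with assms show ?thesis by (simp add: Fin_in_boundary_iff pconc_in_FP psrc_pconc)
next
  case (Inf es)
  with assms shift_in_infinite_paths(1)[of "fst x" "snd x" es] show ?thesis
    by (auto simp: boundary_def FP_def)
qed

lemma brng_bconc:
  assumes "x \<in> FP G" "psrc G x = brng G z"
  shows "brng G (bconc x z) = prng x"
proof (cases z)
  case (Inf es)
  with assms shift_in_infinite_paths(2)[of "fst x" "snd x" es] show ?thesis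
    by (auto simp: FP_def prng_def)
qed simp

lemma cyl_eq_image:
  assumes "x \<in> FP G"
  shows "cyl G x = bconc x ` {z \<in> boundary G. brng G z = psrc G x}"
  using assms by (auto simp: cyl_def bconc_in_boundary) metis

lemma cyl_vpath: "v \<in> verts G \<Longrightarrow> cyl G (vpath v) = {z \<in> boundary G. brng G z = v}"
  by (subst cyl_eq_image) force+

lemma cyl_subset_boundary: "cyl G x \<subseteq> boundary G"
  by (auto simp: cyl_def)

lemma brng_cyl: "x \<in> FP G \<Longrightarrow> z \<in> cyl G x \<Longrightarrow> brng G z = prng x"
  by (auto simp: cyl_eq_image brng_bconc)

lemma brng_verts:
  assumes "z \<in> boundary G" shows "brng G z \<in> verts G"
proof (cases z)
  case (Fin x)
  with assms show ?thesis by (auto simp: boundary_def prng_verts)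
next
  case (Inf es)
  with assms infinite_path_prefix_in_FP[of es 0] show ?thesis
    by (auto simp: boundary_def FP_def)
qed

lemma Fin_in_cyl_iff:
  assumes "x \<in> FP G"
  shows "Fin y \<in> cyl G x \<longleftrightarrow> Fin y \<in> boundary G \<and> path_le G x y"
proof
  assume "Fin y \<in> cyl G x"
  then obtain z where z: "z \<in> boundary G" "psrc G x = brng G z" "Fin y = bconc x z"
    and y: "Fin y \<in> boundary G"
    by (auto simp: cyl_def)
  then show "Fin y \<in> boundary G \<and> path_le G x y"
    by (cases z) (auto simp: path_le_def boundary_def)
next
  assume *: "Fin y \<in> boundary G \<and> path_le G x y"
  then obtain w where w: "w \<in> FP G" "psrc G x = prng w" "y = pconc x w"
    by (auto simp: path_le_def)
  then have "Fin w \<in> boundary G" using * assms bconc_in_boundary[of x "Fin w"] by simp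
  with * w show "Fin y \<in> cyl G x" unfolding cyl_def
    by (auto intro!: bexI[of _ "Fin w"])
qed

lemma Inf_in_cyl_iff:
  assumes "x \<in> FP G"
  shows "Inf es \<in> cyl G x \<longleftrightarrow>
    es \<in> infinite_paths G \<and> x = (head G (shd es), stake (plen x) es)"
proof
  assume L: "Inf es \<in> cyl G x"
  then have "prng x = head G (shd es)" using assms brng_cyl by fastforce
  moreover obtain z where z: "z \<in> boundary G" "Inf es = bconc x z"
    and y: "Inf es \<in> boundary G"
    using L by (auto simp: cyl_def)
  then have "snd x = stake (plen x) es"
    by (cases z) (auto simp: stake_shift plen_def)
  ultimately show "es \<in> infinite_paths G \<and> x = (head G (shd es), stake (plen x) es)"
    using y by (auto simp: boundary_def prng_def prod_eq_iff)
next
  assume R: "es \<in> infinite_paths G \<and> x = (head G (shd es), stake (plen x) es)"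
  define t where "t = sdrop (plen x) es"
  have snd: "snd x = stake (plen x) es" using R by (metis snd_conv)
  have fst: "fst x = head G (shd es)" using R by (metis fst_conv)
  have es: "Inf es = bconc x (Inf t)" by (simp add: snd t_def stake_sdrop)
  have src: "psrc G x = head G (shd t)"
  proof (cases "plen x")
    case 0
    then show ?thesis using fst by (simp add: t_def psrc_def plen_def)
  next
    case (Suc n)
    then have "snd x = stake n es @ [es !! n]" using snd by (simp add: stake_Suc del: stake.simps)
    moreover have "tail G (es !! n) = head G (es !! Suc n)"
      using R by (auto simp: infinite_paths_def)
    ultimately show ?thesis using Suc by (simp add: psrc_def t_def sdrop_simps)
  qed
  have "Inf es \<in> boundary G" using R by (simp add: boundary_def)
  moreover from this have "Inf t \<in> boundary G"
    using bconc_in_boundary[of x "Inf t"] assms es src by simp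
  ultimately show "Inf es \<in> cyl G x" unfolding cyl_def using es src
    by (auto intro!: bexI[of _ "Inf t"])
qed

lemma cyl_anti_mono:
  assumes "x \<in> FP G" "path_le G x y"
  shows "cyl G y \<subseteq> cyl G x"
proof
  obtain w where w: "w \<in> FP G" "psrc G x = prng w" "y = pconc x w"
    using assms by (auto simp: path_le_def)
  fix z assume z: "z \<in> cyl G y"
  then obtain z' where z': "z' \<in> boundary G" "psrc G y = brng G z'" "z = bconc y z'"
    by (auto simp: cyl_def)
  have "psrc G w = brng G z'" using z'(2) w by (simp add: psrc_pconc)
  then have "bconc w z' \<in> boundary G" "brng G (bconc w z') = prng w"
    using w z' by (auto simp: bconc_in_boundary brng_bconc)
  then show "z \<in> cyl G x" using z z' w
    by (auto simp: cyl_def bconc_pconc intro!: bexI[of _ "bconc w z'"])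
qed

text \<open>
  Two prefixes of one boundary path are nested, the shorter one inside the longer one. This is
  what turns statements about the order on finite paths (such as monotonicity of a relation
  morphism) into disjointness of cylinder sets.
\<close>

lemma cyl_meet_path_le:
  assumes "x \<in> FP G" "y \<in> FP G" "z \<in> cyl G x" "z \<in> cyl G y" "plen x \<le> plen y"
  shows "path_le G x y"
proof -
  have "prng x = prng y" using assms brng_cyl by metis
  moreover have "prefix (snd x) (snd y)"
  proof (cases z)
    case (Fin w)
    then have "path_le G x w" "path_le G y w" using assms by (auto simp: Fin_in_cyl_iff)
    then have "prefix (snd x) (snd w)" "prefix (snd y) (snd w)"
      by (simp_all add: path_le_imp_prefix)
    then show ?thesis using assms(5) by (auto simp: plen_def intro: prefix_length_prefix)
  next
    case (Inf es)
    then have "snd x = stake (plen x) es" "snd y = stake (plen y) es"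
      using assms Inf_in_cyl_iff by (metis snd_conv)+
    then have "snd x = take (plen x) (snd y)" using assms(5)
      by (metis min.absorb1 take_stake)
    then show ?thesis by (metis take_is_prefix)
  qed
  ultimately show ?thesis using assms by (simp add: path_le_iff_prefix)
qed

lemma cyl_meet_comparable:
  assumes "x \<in> FP G" "y \<in> FP G" "z \<in> cyl G x" "z \<in> cyl G y"
  shows "path_le G x y \<or> path_le G y x"
  using cyl_meet_path_le assms by (meson linear)

lemma cyl_sibling_edges_disjoint:
  assumes "x \<in> FP G" "e \<in> in_arcs G (psrc G x)" "f \<in> in_arcs G (psrc G x)" "e \<noteq> f"
  shows "cyl G (pconc x (epath G e)) \<inter> cyl G (pconc x (epath G f)) = {}"
proof -
  have "\<not> path_le G (pconc x (epath G e)) (pconc x (epath G f))"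
    using assms by (auto simp: path_le_def pconc_def epath_def)
  then show ?thesis
    using cyl_meet_path_le[of "pconc x (epath G e)" "pconc x (epath G f)"] assms
    by (auto simp: pconc_epath_in_FP)
qed

text \<open>
  The exceptional point \<open>Fin x\<close> is a boundary path only if \<open>s(x)\<close> is not regular, so this writes
  the cylinder of a path with regular source as a finite union of smaller cylinders.
\<close>

lemma cyl_split:
  assumes "x \<in> FP G" "z \<in> cyl G x" "z \<noteq> Fin x"
  shows "\<exists>e\<in>in_arcs G (psrc G x). z \<in> cyl G (pconc x (epath G e))"
proof -
  obtain y where y: "y \<in> FP G" "z \<in> cyl G y" "plen x < plen y"
  proof (cases z)
    case (Fin w)
    then have w: "w \<in> FP G" "path_le G x w" "z \<in> boundary G"
      using assms by (auto simp: Fin_in_cyl_iff boundary_def)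
    then have "prng x = prng w" "prefix (snd x) (snd w)" using assms
      by (auto simp: path_le_iff_prefix)
    moreover have "x \<noteq> w" using Fin assms by auto
    ultimately have "plen x < plen w"
      unfolding plen_def by (metis prefix_length_less prefix_order.less_le prng_def prod_eq_iff)
    moreover have "z \<in> cyl G w" using w Fin by (simp add: Fin_in_cyl_iff path_le_refl)
    ultimately show ?thesis using that w by blast
  next
    case (Inf es)
    then have "es \<in> infinite_paths G" using assms by (simp add: Inf_in_cyl_iff)
    then show ?thesis using Inf infinite_path_prefix_in_FP[of es "Suc (plen x)"]
      by (intro that[of "(head G (shd es), stake (Suc (plen x)) es)"])
        (auto simp: Inf_in_cyl_iff plen_def simp del: stake.simps)
  qed
  have "path_le G x y" using assms y by (intro cyl_meet_path_le[of x y z]) auto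
  then obtain e where e: "e \<in> in_arcs G (psrc G x)" "path_le G (pconc x (epath G e)) y"
    using path_le_first_edge assms y by blast
  then show ?thesis using cyl_anti_mono[of "pconc x (epath G e)" y] assms y
    by (auto simp: pconc_epath_in_FP)
qed


section \<open>Compactness of cylinder sets\<close>

lemma cyl_basic_open:
  assumes "x \<in> FP G" "F \<subseteq> in_arcs G (psrc G x)" "finite F"
  shows "openin (boundary_topology G) (cyl G x - (\<Union>e\<in>F. cyl G (pconc x (epath G e))))"
  using assms unfolding boundary_topology_def
  by (intro topology_generated_by_Basis) blast

lemma openin_cyl: "x \<in> FP G \<Longrightarrow> openin (boundary_topology G) (cyl G x)"
  using cyl_basic_open[of x "{}"] by simp

lemma topspace_boundary: "topspace (boundary_topology G) = boundary G"
proof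
  show "topspace (boundary_topology G) \<subseteq> boundary G"
    unfolding boundary_topology_def topology_generated_by_topspace
    using cyl_subset_boundary by blast
next
  show "boundary G \<subseteq> topspace (boundary_topology G)"
  proof
    fix z assume z: "z \<in> boundary G"
    then have "vpath (brng G z) \<in> FP G" "z \<in> cyl G (vpath (brng G z))"
      by (auto simp: brng_verts cyl_vpath)
    then show "z \<in> topspace (boundary_topology G)"
      using openin_cyl openin_subset by blast
  qed
qed

text \<open>
  A path longer than \<open>y\<close> that extends \<open>y\<close> has a definite next edge after \<open>y\<close>; its cylinder
  therefore lies inside one \<open>cyl G (ye)\<close> and misses all the others. So as soon as it meets a
  basic open set cut out of \<open>cyl G y\<close>, it is contained in that set.
\<close>

lemma cyl_subset_basic_open:
  assumes y: "y \<in> FP G" "F \<subseteq> in_arcs G (psrc G y)" and x: "x \<in> FP G" "plen y < plen x"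
    and z: "z \<in> cyl G x" "z \<in> cyl G y - (\<Union>e\<in>F. cyl G (pconc y (epath G e)))"
  shows "cyl G x \<subseteq> cyl G y - (\<Union>e\<in>F. cyl G (pconc y (epath G e)))"
proof -
  have "path_le G y x" using assms by (intro cyl_meet_path_le[of y x z]) auto
  then obtain e where e: "e \<in> in_arcs G (psrc G y)" "path_le G (pconc y (epath G e)) x"
    using path_le_first_edge x y by blast
  have FP: "pconc y (epath G e) \<in> FP G" using y e by (simp add: pconc_epath_in_FP)
  have sub: "cyl G x \<subseteq> cyl G (pconc y (epath G e))" using cyl_anti_mono FP e by blast
  then have "e \<notin> F" using z by auto
  then have "cyl G (pconc y (epath G e)) \<inter> cyl G (pconc y (epath G f)) = {}" if "f \<in> F" for f
    using cyl_sibling_edges_disjoint[of y e f] that y e by blast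
  moreover have "cyl G (pconc y (epath G e)) \<subseteq> cyl G y"
    using cyl_anti_mono path_le_pconc_epath y e by blast
  ultimately show ?thesis using sub by blast
qed

text \<open>
  Neighbourhood bases at the two kinds of boundary paths. Each of the two properties is
  inherited by unions and by binary intersections, so that it is enough to check it on the
  generating sets.
\<close>

lemma neighbourhood_of_finite_path:
  assumes "openin (boundary_topology G) U" "Fin x \<in> U"
  shows "\<exists>F \<subseteq> in_arcs G (psrc G x). finite F \<and>
    cyl G x - (\<Union>e\<in>F. cyl G (pconc x (epath G e))) \<subseteq> U"
proof -
  have "Fin x \<in> boundary G" using assms openin_subset topspace_boundary by blast
  then have x: "x \<in> FP G" by (auto simp: boundary_def)
  have "generate_topology_on {cyl G x - (\<Union>e\<in>F. cyl G (pconc x (epath G e))) | x F.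
        x \<in> FP G \<and> F \<subseteq> in_arcs G (psrc G x) \<and> finite F} U"
    using assms(1) unfolding boundary_topology_def by (simp add: openin_topology_generated_by_iff)
  then show ?thesis using assms(2)
  proof induction
    case Empty
    then show ?case by simp
  next
    case (Int A B)
    then obtain F F' where
      "F \<subseteq> in_arcs G (psrc G x)" "finite F" "cyl G x - (\<Union>e\<in>F. cyl G (pconc x (epath G e))) \<subseteq> A"
      "F' \<subseteq> in_arcs G (psrc G x)" "finite F'" "cyl G x - (\<Union>e\<in>F'. cyl G (pconc x (epath G e))) \<subseteq> B"
      by blast
    then show ?case by (intro exI[of _ "F \<union> F'"]) auto
  next
    case (UN K)
    then obtain A where A: "A \<in> K" "Fin x \<in> A" by blast
    with UN.IH[OF A] show ?case by blast
  next
    case (Basis B)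
    then obtain y F where B: "B = cyl G y - (\<Union>e\<in>F. cyl G (pconc y (epath G e)))"
      and y: "y \<in> FP G" "F \<subseteq> in_arcs G (psrc G y)" "finite F" by blast
    have le: "path_le G y x" and xx: "Fin x \<in> cyl G x"
      using Basis.prems B x y by (auto simp: Fin_in_cyl_iff path_le_refl)
    show ?case
    proof (cases "x = y")
      case True
      then show ?thesis using B y by blast
    next
      case False
      then have "plen y < plen x" using le x y unfolding path_le_iff_prefix[OF y(1) x] plen_def
        by (metis prefix_length_less prefix_order.less_le prng_def prod_eq_iff)
      then have "cyl G x \<subseteq> B"
        using cyl_subset_basic_open[of y F x "Fin x"] Basis.prems x y xx B by blast
      then show ?thesis by (intro exI[of _ "{}"]) auto
    qed
  qed
qed

lemma neighbourhood_of_infinite_path: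
  assumes "openin (boundary_topology G) U" "Inf es \<in> U"
  shows "\<exists>n. \<forall>m\<ge>n. cyl G (head G (shd es), stake m es) \<subseteq> U"
proof -
  have "Inf es \<in> boundary G" using assms openin_subset topspace_boundary by blast
  then have es: "es \<in> infinite_paths G" by (auto simp: boundary_def)
  have "generate_topology_on {cyl G x - (\<Union>e\<in>F. cyl G (pconc x (epath G e))) | x F.
        x \<in> FP G \<and> F \<subseteq> in_arcs G (psrc G x) \<and> finite F} U"
    using assms(1) unfolding boundary_topology_def by (simp add: openin_topology_generated_by_iff)
  then show ?thesis using assms(2)
  proof induction
    case Empty
    then show ?case by simp
  next
    case (Int A B)
    then obtain n n' where "\<forall>m\<ge>n. cyl G (head G (shd es), stake m es) \<subseteq> A"
      "\<forall>m\<ge>n'. cyl G (head G (shd es), stake m es) \<subseteq> B" by blast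
    then show ?case by (intro exI[of _ "max n n'"]) simp
  next
    case (UN K)
    then obtain A where A: "A \<in> K" "Inf es \<in> A" by blast
    then obtain n where n: "\<forall>m\<ge>n. cyl G (head G (shd es), stake m es) \<subseteq> A"
      using UN.IH by presburger
    have "A \<subseteq> \<Union> K" using A by blast
    then show ?case using n by (intro exI[of _ n]) (meson subset_trans)
  next
    case (Basis B)
    then obtain y F where B: "B = cyl G y - (\<Union>e\<in>F. cyl G (pconc y (epath G e)))"
      and y: "y \<in> FP G" "F \<subseteq> in_arcs G (psrc G y)" "finite F" by blast
    have "cyl G (head G (shd es), stake m es) \<subseteq> B" if "m \<ge> Suc (plen y)" for m
    proof -
      have FP: "(head G (shd es), stake m es) \<in> FP G"
        using infinite_path_prefix_in_FP es by blast
      have mem: "Inf es \<in> cyl G (head G (shd es), stake m es)"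
        using es FP by (simp add: Inf_in_cyl_iff plen_def)
      have less: "plen y < plen (head G (shd es), stake m es)"
        using that by (simp add: plen_def)
      show ?thesis unfolding B
        by (rule cyl_subset_basic_open[OF y(1,2) FP less mem Basis.prems[unfolded B]])
    qed
    then show ?case by blast
  qed
qed

text \<open>
  A property of finite paths that can always be carried over to some one-edge extension holds for
  all long prefixes of some infinite path, by dependent choice. Below it is applied to properties
  that no infinite path can have in this way.
\<close>

lemma infinite_path_of_extensions:
  assumes x: "x \<in> FP G" "P x"
    and ext: "\<And>y. y \<in> FP G \<Longrightarrow> P y \<Longrightarrow> \<exists>e\<in>in_arcs G (psrc G y). P (pconc y (epath G e))"
  shows "\<exists>es. Inf es \<in> cyl G x \<and> (\<forall>n\<ge>plen x. P (head G (shd es), stake n es))"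
proof -
  define c where "c y = (SOME e. e \<in> in_arcs G (psrc G y) \<and> P (pconc y (epath G e)))" for y
  have c: "c y \<in> in_arcs G (psrc G y)" "P (pconc y (epath G (c y)))" if "y \<in> FP G" "P y" for y
    using someI_ex[of "\<lambda>e. e \<in> in_arcs G (psrc G y) \<and> P (pconc y (epath G e))"] ext[OF that]
    unfolding c_def by blast+
  define X where "X n = ((\<lambda>y. pconc y (epath G (c y))) ^^ n) x" for n
  have X_Suc: "X (Suc n) = pconc (X n) (epath G (c (X n)))" for n by (simp add: X_def)
  have X: "X n \<in> FP G \<and> P (X n)" for n
  proof (induction n)
    case 0
    then show ?case using x by (simp add: X_def)
  next
    case (Suc n)
    then show ?case using c by (simp add: X_Suc pconc_epath_in_FP)
  qed
  define t where "t = smap (\<lambda>n. c (X n)) (fromN 0)"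
  have t: "t !! n = c (X n)" for n by (simp add: t_def)
  have word: "snd (X n) = snd x @ stake n t" for n
  proof (induction n)
    case 0
    then show ?case by (simp add: X_def)
  next
    case (Suc n)
    then show ?case by (simp add: X_Suc pconc_def epath_def stake_Suc t del: stake.simps)
  qed
  have rng: "prng (X n) = prng x" for n
    by (induction n) (auto simp: X_Suc X_def)
  have t_head: "head G (t !! n) = psrc G (X n)" and t_arc: "t !! n \<in> arcs G" for n
    using c(1)[of "X n"] X by (auto simp: t)
  have "tail G (t !! n) = head G (t !! Suc n)" for n
    using t_head[of n] t_head[of "Suc n"] by (simp add: X_Suc psrc_pconc t)
  then have "t \<in> infinite_paths G" using t_arc by (simp add: infinite_paths_def)
  moreover have src: "psrc G x = head G (shd t)" using t_head[of 0] by (simp add: X_def)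
  ultimately have "Inf (snd x @- t) \<in> cyl G x"
    using x by (auto simp: cyl_eq_image boundary_def intro!: image_eqI[of _ _ "Inf t"])
  moreover have "P (head G (shd (snd x @- t)), stake n (snd x @- t))" if "n \<ge> plen x" for n
  proof -
    have "head G (shd (snd x @- t)) = prng x"
      using shift_in_infinite_paths(2)[of "fst x" "snd x" t] x src
      by (auto simp: FP_def prng_def)
    moreover have "stake n (snd x @- t) = snd (X (n - plen x))"
      using that by (simp add: word stake_shift plen_def)
    ultimately have "(head G (shd (snd x @- t)), stake n (snd x @- t)) = X (n - plen x)"
      using rng by (simp add: prod_eq_iff prng_def)
    then show ?thesis using X by simp
  qed
  ultimately show ?thesis by blast
qed

text \<open>
  If \<open>cyl G y\<close> is empty, then \<open>y\<close> itself is not a boundary path, so its source is regular and \<open>y\<close>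
  has an extension by an edge, whose cylinder is empty again. Iterating produces a point of the
  cylinder after all.
\<close>

lemma cyl_nonempty:
  assumes "x \<in> FP G" shows "cyl G x \<noteq> {}"
proof
  assume empty: "cyl G x = {}"
  have "\<exists>e\<in>in_arcs G (psrc G y). cyl G (pconc y (epath G e)) = {}"
    if y: "y \<in> FP G" "cyl G y = {}" for y
  proof -
    have "regular_vertex G (psrc G y)"
    proof (rule ccontr)
      assume "\<not> regular_vertex G (psrc G y)"
      then have "Fin y \<in> cyl G y" using y(1)
        by (simp add: Fin_in_cyl_iff path_le_refl Fin_in_boundary_iff)
      with y show False by simp
    qed
    then obtain e where e: "e \<in> in_arcs G (psrc G y)" unfolding regular_vertex_def by blast
    then have "cyl G (pconc y (epath G e)) \<subseteq> cyl G y"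
      using cyl_anti_mono path_le_pconc_epath y by blast
    then show ?thesis using y e by auto
  qed
  then obtain es where "Inf es \<in> cyl G x"
    using infinite_path_of_extensions[of x "\<lambda>y. cyl G y = {}"] assms empty by blast
  with empty show False by simp
qed

text \<open>
  If a cover had no finite subcover of \<open>cyl G x\<close>, then the same would hold for some one-edge
  extension of \<open>x\<close>: either \<open>s(x)\<close> is regular and \<open>cyl G x\<close> is a finite union of such
  extensions, or \<open>x\<close> is itself a point and the member of the cover that contains it leaves
  only finitely many extensions. Iterating yields an infinite path all of whose long prefixes
  have this defect, although a member of the cover containing that path contains the
  cylinder of a long prefix.
\<close>

lemma compactin_cyl:
  assumes x: "x \<in> FP G"
  shows "compactin (boundary_topology G) (cyl G x)"
  unfolding compactin_def
proof (intro conjI allI impI)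
  show "cyl G x \<subseteq> topspace (boundary_topology G)"
    by (simp add: topspace_boundary cyl_subset_boundary)
next
  fix \<U> assume "Ball \<U> (openin (boundary_topology G)) \<and> cyl G x \<subseteq> \<Union> \<U>"
  then have op: "\<And>U. U \<in> \<U> \<Longrightarrow> openin (boundary_topology G) U" and cov: "cyl G x \<subseteq> \<Union> \<U>" by auto
  define covered where "covered A \<longleftrightarrow> (\<exists>\<F>. finite \<F> \<and> \<F> \<subseteq> \<U> \<and> A \<subseteq> \<Union> \<F>)" for A
  have covered_mono: "covered A" if "covered B" "A \<subseteq> B" for A B
    using that unfolding covered_def by (meson subset_trans)
  have covered_Un: "covered (A \<union> B)" if A: "covered A" and B: "covered B" for A B
  proof -
    obtain \<F> \<F>' where "finite \<F>" "\<F> \<subseteq> \<U>" "A \<subseteq> \<Union> \<F>" "finite \<F>'" "\<F>' \<subseteq> \<U>" "B \<subseteq> \<Union> \<F>'"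
      using A B unfolding covered_def by blast
    then show ?thesis unfolding covered_def by (intro exI[of _ "\<F> \<union> \<F>'"]) auto
  qed
  have covered_member: "covered A" if "U \<in> \<U>" "A \<subseteq> U" for A U
    using that unfolding covered_def by (intro exI[of _ "{U}"]) simp
  have covered_UN: "covered (\<Union>e\<in>F. A e)" if "finite F" "\<And>e. e \<in> F \<Longrightarrow> covered (A e)"
    for F :: "'b set" and A
    using that
  proof (induction F)
    case empty
    then show ?case unfolding covered_def by (intro exI[of _ "{}"]) auto
  next
    case (insert e F)
    then show ?case by (simp add: covered_Un)
  qed
  have "covered (cyl G x)"
  proof (rule ccontr)
    assume bad: "\<not> covered (cyl G x)"
    define P where "P y \<longleftrightarrow> cyl G y \<subseteq> cyl G x \<and> \<not> covered (cyl G y)" for y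
    have step: "\<exists>e\<in>in_arcs G (psrc G y). P (pconc y (epath G e))" if y: "y \<in> FP G" "P y" for y
    proof (rule ccontr)
      assume "\<not> ?thesis"
      moreover have "cyl G (pconc y (epath G e)) \<subseteq> cyl G x" if "e \<in> in_arcs G (psrc G y)" for e
        using cyl_anti_mono[OF y(1) path_le_pconc_epath[OF y(1) that]] y(2)
        unfolding P_def by blast
      ultimately have ext: "covered (cyl G (pconc y (epath G e)))"
        if "e \<in> in_arcs G (psrc G y)" for e
        using that unfolding P_def by meson
      have "covered (cyl G y)"
      proof (cases "Fin y \<in> cyl G y")
        case True
        moreover have "cyl G y \<subseteq> \<Union> \<U>" using y(2) cov unfolding P_def by (meson subset_trans)
        ultimately obtain U where U: "U \<in> \<U>" "Fin y \<in> U" by (meson UnionE subsetD)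
        obtain F where F: "F \<subseteq> in_arcs G (psrc G y)" "finite F"
          "cyl G y - (\<Union>e\<in>F. cyl G (pconc y (epath G e))) \<subseteq> U"
          using neighbourhood_of_finite_path[OF op[OF U(1)] U(2)] by (elim exE conjE) (rule that)
        have "covered ((\<Union>e\<in>F. cyl G (pconc y (epath G e))) \<union> U)"
        proof (rule covered_Un)
          show "covered (\<Union>e\<in>F. cyl G (pconc y (epath G e)))"
            using F(1) by (intro covered_UN[OF F(2)] ext) blast
          show "covered U" using U(1) covered_member by blast
        qed
        moreover have "cyl G y \<subseteq> (\<Union>e\<in>F. cyl G (pconc y (epath G e))) \<union> U"
          using F(3) by blast
        ultimately show ?thesis by (rule covered_mono)
      next
        case False
        then have "regular_vertex G (psrc G y)" using y(1)
          by (simp add: Fin_in_cyl_iff path_le_refl Fin_in_boundary_iff)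
        then have "finite (in_arcs G (psrc G y))" by (simp add: regular_vertex_def)
        then have "covered (\<Union>e\<in>in_arcs G (psrc G y). cyl G (pconc y (epath G e)))"
          using ext by (rule covered_UN)
        moreover have "cyl G y \<subseteq> (\<Union>e\<in>in_arcs G (psrc G y). cyl G (pconc y (epath G e)))"
          proof
          fix z assume "z \<in> cyl G y"
          moreover from this False have "z \<noteq> Fin y" by blast
          ultimately show "z \<in> (\<Union>e\<in>in_arcs G (psrc G y). cyl G (pconc y (epath G e)))"
            using cyl_split[OF y(1)] by blast
        qed
        ultimately show ?thesis by (rule covered_mono)
      qed
      then show False using y unfolding P_def by blast
    qed
    have "P x" using bad by (simp add: P_def)
    then obtain es where es: "Inf es \<in> cyl G x" "\<forall>n\<ge>plen x. P (head G (shd es), stake n es)"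
      using infinite_path_of_extensions[OF x _ step] by blast
    then obtain U where U: "U \<in> \<U>" "Inf es \<in> U" using cov by blast
    then obtain n where n: "\<forall>m\<ge>n. cyl G (head G (shd es), stake m es) \<subseteq> U"
      using neighbourhood_of_infinite_path op by blast
    have "covered (cyl G (head G (shd es), stake (max n (plen x)) es))"
      using n U by (intro covered_member[of U]) auto
    moreover have "P (head G (shd es), stake (max n (plen x)) es)" using es(2) by simp
    ultimately show False unfolding P_def by blast
  qed
  then show "\<exists>\<F>. finite \<F> \<and> \<F> \<subseteq> \<U> \<and> cyl G x \<subseteq> \<Union> \<F>" unfolding covered_def .
qed


section \<open>The bisections of finite paths\<close>

lemma Zarr_vpath_psrc:
  "Zarr G x (vpath (psrc G x)) =
     {(bconc x z, int (plen x), z) | z. z \<in> boundary G \<and> brng G z = psrc G x}"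
  unfolding Zarr_def arrow_set_def by (auto; force)

lemma openin_Zarr:
  assumes "x \<in> FP G" "y \<in> FP G" "psrc G x = psrc G y"
  shows "openin (boundary_arrow_topology G) (Zarr G x y)"
  unfolding boundary_arrow_topology_def Zarr_def
proof (rule topology_generated_by_Basis, intro CollectI exI conjI refl)
  have "{z \<in> boundary G. brng G z = psrc G x} = cyl G (vpath (psrc G x))"
    using assms by (simp add: cyl_vpath psrc_verts)
  then show "openin (boundary_topology G) {z \<in> boundary G. brng G z = psrc G x}"
    and "{z \<in> boundary G. brng G z = psrc G x} \<subseteq> cyl G (vpath (psrc G x))"
    using assms by (auto simp: openin_cyl psrc_verts)
qed (use assms in auto)

lemma grng_Zarr:
  assumes "x \<in> FP G"
  shows "grng (boundary_groupoid G) ` Zarr G x (vpath (psrc G x)) = cyl G x"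
  using assms unfolding Zarr_vpath_psrc
  by (force simp: cyl_eq_image boundary_groupoid_def)

lemma gsrc_Zarr:
  assumes "x \<in> FP G"
  shows "gsrc (boundary_groupoid G) ` Zarr G x (vpath (psrc G x)) = cyl G (vpath (psrc G x))"
  using assms unfolding Zarr_vpath_psrc
  by (force simp: cyl_vpath psrc_verts boundary_groupoid_def)

lemma gset_mult_units:
  "gset_mult (boundary_groupoid G) (gunit (boundary_groupoid G) ` A) (gunit (boundary_groupoid G) ` B)
     = gunit (boundary_groupoid G) ` (A \<inter> B)"
  unfolding gset_mult_def boundary_groupoid_def by force

lemma gset_mult_unit_right:
  "gset_mult (boundary_groupoid G) T (gunit (boundary_groupoid G) ` B)
     = {t \<in> T. gsrc (boundary_groupoid G) t \<in> B}"
  unfolding gset_mult_def boundary_groupoid_def by force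

end


section \<open>The family of an admissible relation morphism\<close>

locale admissible_morphism = wf_digraph \<Gamma> + target: wf_digraph \<Gamma>'
  for \<Gamma> :: "('v, 'e) pre_digraph" and \<Gamma>' :: "('w, 'f) pre_digraph" +
  fixes R :: "(('v, 'e) fpath \<times> ('w, 'f) fpath) set"
  assumes admissible: "admissible_relation_morphism \<Gamma> \<Gamma>' R"
begin

lemma R_in_FP: "(x, y) \<in> R \<Longrightarrow> x \<in> FP \<Gamma>"
  using admissible by (auto simp: admissible_relation_morphism_def relation_morphism_def)

lemma R_vertex:
  assumes "(x, vpath v) \<in> R" "v \<in> verts \<Gamma>'"
  obtains u where "u \<in> verts \<Gamma>" "x = vpath u"
  using admissible assms unfolding admissible_relation_morphism_def relation_morphism_def by blast

lemma R_prng: "(x, y) \<in> R \<Longrightarrow> (vpath (prng x), vpath (prng y)) \<in> R"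
  using admissible unfolding admissible_relation_morphism_def relation_morphism_def by meson

lemma R_proper: "y \<in> FP \<Gamma>' \<Longrightarrow> finite (Rinv R y)"
  using admissible by (auto simp: admissible_relation_morphism_def rel_proper_def)

lemma R_vertex_disjoint:
  "v \<in> verts \<Gamma>' \<Longrightarrow> v' \<in> verts \<Gamma>' \<Longrightarrow> (x, vpath v) \<in> R \<Longrightarrow> (x, vpath v') \<in> R \<Longrightarrow> v = v'"
  using admissible
  by (auto simp: admissible_relation_morphism_def rel_vertex_disjoint_def Rinv_def)

lemma R_source_bij:
  "f \<in> arcs \<Gamma>' \<Longrightarrow> bij_betw (\<lambda>x. vpath (psrc \<Gamma> x)) (Rinv R (epath \<Gamma>' f)) (Rinv R (vpath (tail \<Gamma>' f)))"
  using admissible by (auto simp: admissible_relation_morphism_def rel_source_bijective_def)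

lemma R_source_inj:
  assumes "f \<in> arcs \<Gamma>'" "(x, epath \<Gamma>' f) \<in> R" "(x', epath \<Gamma>' f) \<in> R" "psrc \<Gamma> x = psrc \<Gamma> x'"
  shows "x = x'"
  using inj_onD[OF bij_betw_imp_inj_on[OF R_source_bij[OF assms(1)]], of x x'] assms(2-)
  by (simp add: Rinv_def)

text \<open>
  By monotonicity, the paths related to edges form an antichain for the prefix order, so that
  a boundary path has at most one of them as a prefix.
\<close>

lemma R_edge_cyl_unique:
  assumes f: "f \<in> arcs \<Gamma>'" "(x, epath \<Gamma>' f) \<in> R" and f': "f' \<in> arcs \<Gamma>'" "(x', epath \<Gamma>' f') \<in> R"
    and z: "z \<in> cyl \<Gamma> x" "z \<in> cyl \<Gamma> x'"
  shows "x = x' \<and> f = f'"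
proof -
  have mono: "(a, g) = (a', g')"
    if "g \<in> arcs \<Gamma>'" "g' \<in> arcs \<Gamma>'" "(a, epath \<Gamma>' g) \<in> R" "(a', epath \<Gamma>' g') \<in> R" "path_le \<Gamma> a a'"
    for a a' g g'
    using admissible that unfolding admissible_relation_morphism_def rel_monotone_def by blast
  have "path_le \<Gamma> x x' \<or> path_le \<Gamma> x' x"
    using cyl_meet_comparable f f' z R_in_FP by blast
  then show ?thesis using mono[of f f' x x'] mono[of f' f x' x] f f' by auto
qed

lemma rel_Omega_iff:
  assumes "v \<in> verts \<Gamma>'"
  shows "z \<in> rel_Omega \<Gamma> R v \<longleftrightarrow> z \<in> boundary \<Gamma> \<and> (vpath (brng \<Gamma> z), vpath v) \<in> R"
proof
  assume "z \<in> rel_Omega \<Gamma> R v"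
  then obtain x where x: "(x, vpath v) \<in> R" "z \<in> cyl \<Gamma> x" by (auto simp: rel_Omega_def Rinv_def)
  then obtain u where "u \<in> verts \<Gamma>" "x = vpath u" using assms R_vertex by blast
  with x show "z \<in> boundary \<Gamma> \<and> (vpath (brng \<Gamma> z), vpath v) \<in> R" by (auto simp: cyl_vpath)
next
  assume "z \<in> boundary \<Gamma> \<and> (vpath (brng \<Gamma> z), vpath v) \<in> R"
  then show "z \<in> rel_Omega \<Gamma> R v" unfolding rel_Omega_def Rinv_def
    using brng_verts cyl_vpath by fastforce
qed

lemma rel_T_iff:
  "(a, k, z) \<in> rel_T \<Gamma> \<Gamma>' R f \<longleftrightarrow> (\<exists>x. (x, epath \<Gamma>' f) \<in> R \<and> a = bconc x z \<and> k = int (plen x) \<and>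
     z \<in> boundary \<Gamma> \<and> brng \<Gamma> z = psrc \<Gamma> x)"
  by (auto simp: rel_T_def Rinv_def Zarr_vpath_psrc)

lemma grng_rel_T:
  "grng (boundary_groupoid \<Gamma>) ` rel_T \<Gamma> \<Gamma>' R f = (\<Union>x\<in>Rinv R (epath \<Gamma>' f). cyl \<Gamma> x)"
  unfolding rel_T_def image_UN by (intro SUP_cong refl grng_Zarr) (auto simp: Rinv_def R_in_FP)

lemma gsrc_rel_T:
  assumes "f \<in> arcs \<Gamma>'"
  shows "gsrc (boundary_groupoid \<Gamma>) ` rel_T \<Gamma> \<Gamma>' R f = rel_Omega \<Gamma> R (tail \<Gamma>' f)"
proof -
  have "gsrc (boundary_groupoid \<Gamma>) ` rel_T \<Gamma> \<Gamma>' R f =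
      (\<Union>x\<in>Rinv R (epath \<Gamma>' f). cyl \<Gamma> (vpath (psrc \<Gamma> x)))"
    unfolding rel_T_def image_UN by (intro SUP_cong refl gsrc_Zarr) (auto simp: Rinv_def R_in_FP)
  also have "\<dots> = rel_Omega \<Gamma> R (tail \<Gamma>' f)"
    unfolding rel_Omega_def using bij_betw_imp_surj_on[OF R_source_bij[OF assms]]
    by (metis (no_types, lifting) SUP_cong image_image)
  finally show ?thesis .
qed

lemma rel_Omega_compact_open:
  assumes "v \<in> verts \<Gamma>'"
  shows "openin (boundary_topology \<Gamma>) (rel_Omega \<Gamma> R v)"
    and "compactin (boundary_topology \<Gamma>) (rel_Omega \<Gamma> R v)"
proof -
  show "openin (boundary_topology \<Gamma>) (rel_Omega \<Gamma> R v)"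
    unfolding rel_Omega_def Rinv_def using openin_cyl R_in_FP by blast
  have "finite (Rinv R (vpath v))" using R_proper assms by simp
  then show "compactin (boundary_topology \<Gamma>) (rel_Omega \<Gamma> R v)"
    unfolding rel_Omega_def
    by (intro compactin_Union) (auto simp: Rinv_def compactin_cyl R_in_FP)
qed

lemma rel_T_bisection:
  assumes f: "f \<in> arcs \<Gamma>'"
  shows "bisection (boundary_groupoid \<Gamma>) (rel_T \<Gamma> \<Gamma>' R f)"
  unfolding bisection_def
proof (intro conjI)
  have "openin (boundary_arrow_topology \<Gamma>) (Zarr \<Gamma> x (vpath (psrc \<Gamma> x)))"
    if "x \<in> Rinv R (epath \<Gamma>' f)" for x
    using that R_in_FP psrc_verts by (intro openin_Zarr) (auto simp: Rinv_def)
  then show "openin (garr (boundary_groupoid \<Gamma>)) (rel_T \<Gamma> \<Gamma>' R f)"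
    unfolding rel_T_def boundary_groupoid_def by auto
next
  show "inj_on (gsrc (boundary_groupoid \<Gamma>)) (rel_T \<Gamma> \<Gamma>' R f)"
    using R_source_inj[OF f] by (force simp: inj_on_def boundary_groupoid_def rel_T_iff)
next
  show "inj_on (grng (boundary_groupoid \<Gamma>)) (rel_T \<Gamma> \<Gamma>' R f)"
  proof (rule inj_onI)
    fix t t'
    assume mem: "t \<in> rel_T \<Gamma> \<Gamma>' R f" "t' \<in> rel_T \<Gamma> \<Gamma>' R f"
      and eq: "grng (boundary_groupoid \<Gamma>) t = grng (boundary_groupoid \<Gamma>) t'"
    obtain a k z a' k' z' where t: "t = (a, k, z)" "t' = (a', k', z')"
      by (cases t; cases t')
    with mem obtain x x' where
      x: "(x, epath \<Gamma>' f) \<in> R" "a = bconc x z" "k = int (plen x)" "z \<in> boundary \<Gamma>"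
        "brng \<Gamma> z = psrc \<Gamma> x" and
      x': "(x', epath \<Gamma>' f) \<in> R" "a' = bconc x' z'" "k' = int (plen x')" "z' \<in> boundary \<Gamma>"
        "brng \<Gamma> z' = psrc \<Gamma> x'"
      unfolding t rel_T_iff by blast
    have aa: "a = a'" using eq by (simp add: t boundary_groupoid_def)
    have "a \<in> cyl \<Gamma> x" "a' \<in> cyl \<Gamma> x'" using x x' R_in_FP by (auto simp: cyl_eq_image)
    then have xx: "x = x'" using R_edge_cyl_unique f x(1) x'(1) unfolding aa by blast
    have "bconc x z = bconc x z'" using aa unfolding x(2) x'(2) xx .
    moreover have "brng \<Gamma> z = brng \<Gamma> z'" unfolding x(5) x'(5) xx ..
    ultimately have "z = z'" by (rule bconc_left_cancel)
    moreover have "k = k'" unfolding x(3) x'(3) xx ..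
    ultimately show "t = t'" using aa t by simp
  qed
qed

text \<open>
  This is where the regularity of the relation and the topology of the boundary path space have
  to match. For a regular vertex \<open>v\<close>, only finitely many paths are related to edges with range \<open>v\<close>, say to
  form the set \<open>L\<close>. A boundary path starting in \<open>R\<inverse>(v)\<close> passes through one of them: for an infinite
  path, compare a prefix longer than all members of \<open>L\<close> with a member of \<open>L\<close>; for a finite path \<open>x\<close>,
  if no member of \<open>L\<close> is a prefix of \<open>x\<close>, then each one-edge extension \<open>xe\<close> is a prefix of a
  member of \<open>L\<close>, so that \<open>s(x)\<close> receives only finitely many edges. As \<open>s(x)\<close> is not regular, it
  receives none, and the member of \<open>L\<close> comparable to \<open>x\<close> can only be \<open>x\<close> itself.
\<close>

lemma rel_Omega_regular:
  assumes v: "regular_vertex \<Gamma>' v"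
  shows "rel_Omega \<Gamma> R v \<subseteq> (\<Union>f\<in>in_arcs \<Gamma>' v. grng (boundary_groupoid \<Gamma>) ` rel_T \<Gamma> \<Gamma>' R f)"
proof
  fix z assume "z \<in> rel_Omega \<Gamma> R v"
  moreover have vV: "v \<in> verts \<Gamma>'" using v by (simp add: regular_vertex_def)
  ultimately have z: "z \<in> boundary \<Gamma>" "(vpath (brng \<Gamma> z), vpath v) \<in> R"
    by (auto simp: rel_Omega_iff)
  define L where "L = (\<Union>f\<in>in_arcs \<Gamma>' v. Rinv R (epath \<Gamma>' f))"
  have L_finite: "finite L" unfolding L_def
    using v by (auto simp: regular_vertex_def R_proper)
  have L_FP: "y \<in> FP \<Gamma>" if "y \<in> L" for y using that R_in_FP unfolding L_def Rinv_def by blast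
  have comparable: "\<exists>y\<in>L. path_le \<Gamma> x y \<or> path_le \<Gamma> y x"
    if x: "x \<in> FP \<Gamma>" "prng x = brng \<Gamma> z" for x
  proof -
    obtain y f where "(y, epath \<Gamma>' f) \<in> R" "f \<in> arcs \<Gamma>'" "head \<Gamma>' f = v" "path_comparable \<Gamma> x y"
      using admissible x v z(2)
      unfolding admissible_relation_morphism_def rel_regular_def Rinv_def by blast
    moreover from this have "y \<in> L" unfolding L_def Rinv_def by auto
    ultimately show ?thesis unfolding path_comparable_def by blast
  qed
  have "\<exists>y\<in>L. z \<in> cyl \<Gamma> y"
  proof (cases z)
    case (Inf es)
    then have es: "es \<in> infinite_paths \<Gamma>" using z by (auto simp: boundary_def)
    obtain n where n: "\<And>y. y \<in> L \<Longrightarrow> plen y \<le> n"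
      using L_finite finite_nat_set_iff_bounded_le[of "plen ` L"] by auto
    define x where "x = (head \<Gamma> (shd es), stake n es)"
    have x: "x \<in> FP \<Gamma>" "prng x = brng \<Gamma> z" "plen x = n"
      using infinite_path_prefix_in_FP es by (auto simp: x_def Inf prng_def plen_def)
    have zx: "z \<in> cyl \<Gamma> x" using Inf_in_cyl_iff[OF x(1)] es x(3) Inf by (simp add: x_def)
    obtain y where y: "y \<in> L" "path_le \<Gamma> x y \<or> path_le \<Gamma> y x" using comparable x by blast
    then have "path_le \<Gamma> y x"
    proof (elim disjE)
      assume le: "path_le \<Gamma> x y"
      then have "prefix (snd x) (snd y)" "prng x = prng y"
        using x y L_FP by (auto simp: path_le_iff_prefix)
      moreover have "length (snd y) \<le> length (snd x)" using n[OF y(1)] x(3) by (simp add: plen_def)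
      ultimately have "x = y"
        by (metis prefix_length_le prefix_order.antisym prefix_length_prefix prefix_order.refl
            prng_def prod_eq_iff)
      then show ?thesis using x path_le_refl by blast
    qed
    then have "cyl \<Gamma> x \<subseteq> cyl \<Gamma> y" using cyl_anti_mono L_FP y by blast
    with zx y show ?thesis by blast
  next
    case (Fin x)
    then have x: "x \<in> FP \<Gamma>" "\<not> regular_vertex \<Gamma> (psrc \<Gamma> x)" "prng x = brng \<Gamma> z"
      using z by (auto simp: boundary_def)
    have "\<exists>y\<in>L. path_le \<Gamma> y x"
    proof (rule ccontr)
      assume none: "\<not> ?thesis"
      \<comment> \<open>A member of \<open>L\<close> extending \<open>xe\<close> determines \<open>e\<close> as its letter at position \<open>plen x\<close>.\<close>
      have "in_arcs \<Gamma> (psrc \<Gamma> x) \<subseteq> (\<lambda>y. snd y ! plen x) ` L"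
      proof
        fix e assume e: "e \<in> in_arcs \<Gamma> (psrc \<Gamma> x)"
        let ?xe = "pconc x (epath \<Gamma> e)"
        have xe: "?xe \<in> FP \<Gamma>" using pconc_epath_in_FP x e by blast
        obtain y where y: "y \<in> L" "path_le \<Gamma> ?xe y \<or> path_le \<Gamma> y ?xe"
          using comparable[of ?xe] xe x by auto
        have "\<not> prefix (snd y) (snd x)" if "prng y = prng x"
          using none y x L_FP path_le_iff_prefix that by blast
        moreover have "prng y = prng x"
          using y xe L_FP path_le_iff_prefix by (metis prng_pconc)
        moreover have "prefix (snd ?xe) (snd y) \<or> prefix (snd y) (snd x @ [e])"
          using y xe L_FP path_le_iff_prefix by (auto simp: pconc_def epath_def)
        ultimately have "prefix (snd x @ [e]) (snd y)"
          by (auto simp: pconc_def epath_def)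
        then have "snd y ! plen x = e" by (auto simp: prefix_def plen_def nth_append)
        then show "e \<in> (\<lambda>y. snd y ! plen x) ` L" using y by blast
      qed
      then have "finite (in_arcs \<Gamma> (psrc \<Gamma> x))" using L_finite finite_surj by blast
      then have no_arcs: "in_arcs \<Gamma> (psrc \<Gamma> x) = {}"
        using x psrc_verts by (auto simp: regular_vertex_def)
      obtain y where y: "y \<in> L" "path_le \<Gamma> x y" using comparable x none by blast
      have "\<not> plen x < plen y"
        using path_le_first_edge[of x y] x y L_FP no_arcs by blast
      then have "x = y"
        using y(2) by (auto simp: path_le_def plen_def pconc_def prod_eq_iff)
      then show False using none y x path_le_refl by blast
    qed
    then show ?thesis using Fin x z L_FP by (auto simp: Fin_in_cyl_iff)
  qed
  then show "z \<in> (\<Union>f\<in>in_arcs \<Gamma>' v. grng (boundary_groupoid \<Gamma>) ` rel_T \<Gamma> \<Gamma>' R f)"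
    unfolding grng_rel_T L_def by blast
qed

lemma grng_rel_T_subset:
  assumes "f \<in> arcs \<Gamma>'"
  shows "grng (boundary_groupoid \<Gamma>) ` rel_T \<Gamma> \<Gamma>' R f \<subseteq> rel_Omega \<Gamma> R (head \<Gamma>' f)"
proof
  fix z assume "z \<in> grng (boundary_groupoid \<Gamma>) ` rel_T \<Gamma> \<Gamma>' R f"
  then obtain x where x: "(x, epath \<Gamma>' f) \<in> R" "z \<in> cyl \<Gamma> x"
    by (auto simp: grng_rel_T Rinv_def)
  then have "brng \<Gamma> z = prng x" "z \<in> boundary \<Gamma>"
    using brng_cyl R_in_FP cyl_subset_boundary by blast+
  with R_prng[OF x(1)] assms show "z \<in> rel_Omega \<Gamma> R (head \<Gamma>' f)"
    by (simp add: rel_Omega_iff)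
qed

lemma rel_dynamical_CK_family:
  "dynamical_CK_family \<Gamma>' (boundary_groupoid \<Gamma>) (rel_Omega \<Gamma> R) (rel_T \<Gamma> \<Gamma>' R)"
  unfolding dynamical_CK_family_def
proof (intro conjI ballI impI allI)
  fix v w assume "v \<in> verts \<Gamma>'" "w \<in> verts \<Gamma>'" "v \<noteq> w"
  then show "rel_Omega \<Gamma> R v \<inter> rel_Omega \<Gamma> R w = {}"
    using R_vertex_disjoint unfolding disjoint_iff by (metis rel_Omega_iff)
next
  fix e f assume "e \<in> arcs \<Gamma>'" "f \<in> arcs \<Gamma>'" "e \<noteq> f"
  then show "grng (boundary_groupoid \<Gamma>) ` rel_T \<Gamma> \<Gamma>' R e \<inter>
      grng (boundary_groupoid \<Gamma>) ` rel_T \<Gamma> \<Gamma>' R f = {}"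
    unfolding grng_rel_T Rinv_def using R_edge_cyl_unique by blast
next
  fix v assume v: "regular_vertex \<Gamma>' v"
  have "(\<Union>e\<in>in_arcs \<Gamma>' v. grng (boundary_groupoid \<Gamma>) ` rel_T \<Gamma> \<Gamma>' R e) \<subseteq> rel_Omega \<Gamma> R v"
    using grng_rel_T_subset by fastforce
  then show "(\<Union>e\<in>in_arcs \<Gamma>' v. grng (boundary_groupoid \<Gamma>) ` rel_T \<Gamma> \<Gamma>' R e) = rel_Omega \<Gamma> R v"
    using rel_Omega_regular[OF v] by blast
next
  fix v assume "v \<in> verts \<Gamma>'"
  then show "openin (gobj (boundary_groupoid \<Gamma>)) (rel_Omega \<Gamma> R v)"
    and "compactin (gobj (boundary_groupoid \<Gamma>)) (rel_Omega \<Gamma> R v)"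
    using rel_Omega_compact_open by (auto simp: boundary_groupoid_def)
qed (use rel_T_bisection gsrc_rel_T grng_rel_T_subset in blast)+

text \<open>
  Since every vertex is the range of some boundary path, the sets \<open>rel_Omega \<Gamma> R v\<close> can cover the
  boundary only if every vertex is related to some vertex.
\<close>

lemma rel_nondegenerate_iff:
  "nondegenerate_CK_family \<Gamma>' (boundary_groupoid \<Gamma>) (rel_Omega \<Gamma> R) (rel_T \<Gamma> \<Gamma>' R) \<longleftrightarrow>
     (\<Union>v\<in>verts \<Gamma>'. Rinv R (vpath v)) = vpath ` verts \<Gamma>"
proof -
  have sub: "(\<Union>v\<in>verts \<Gamma>'. Rinv R (vpath v)) \<subseteq> vpath ` verts \<Gamma>"
    using R_vertex unfolding Rinv_def by blast
  have "boundary \<Gamma> = (\<Union>v\<in>verts \<Gamma>'. rel_Omega \<Gamma> R v) \<longleftrightarrow>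
      (\<forall>z\<in>boundary \<Gamma>. \<exists>v\<in>verts \<Gamma>'. (vpath (brng \<Gamma> z), vpath v) \<in> R)"
    by (auto simp: rel_Omega_iff set_eq_iff)
  also have "\<dots> \<longleftrightarrow> (\<forall>u\<in>verts \<Gamma>. \<exists>v\<in>verts \<Gamma>'. (vpath u, vpath v) \<in> R)"
  proof -
    have "\<exists>z\<in>boundary \<Gamma>. brng \<Gamma> z = u" if "u \<in> verts \<Gamma>" for u
      using cyl_nonempty[of "vpath u"] cyl_vpath[of u] that by auto
    then show ?thesis using brng_verts by metis
  qed
  also have "\<dots> \<longleftrightarrow> (\<Union>v\<in>verts \<Gamma>'. Rinv R (vpath v)) = vpath ` verts \<Gamma>"
    using sub by (auto simp: Rinv_def)
  finally show ?thesis
    using rel_dynamical_CK_family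
    by (simp add: nondegenerate_CK_family_def boundary_groupoid_def topspace_boundary)
qed

lemma cyl_vpath_Int_rel_Omega:
  assumes "u \<in> verts \<Gamma>" "v \<in> verts \<Gamma>'"
  shows "cyl \<Gamma> (vpath u) \<inter> rel_Omega \<Gamma> R v = (if (vpath u, vpath v) \<in> R then cyl \<Gamma> (vpath u) else {})"
  using assms by (auto simp: rel_Omega_iff cyl_vpath)

text \<open>
  The arrows of \<open>rel_T \<Gamma> \<Gamma>' R f\<close> whose source has range \<open>u\<close> all come from one path, because at most
  one path in \<open>R\<inverse>(f)\<close> has source \<open>u\<close>.
\<close>

lemma rel_T_restrict:
  assumes "u \<in> verts \<Gamma>" "f \<in> arcs \<Gamma>'"
  shows "{t \<in> rel_T \<Gamma> \<Gamma>' R f. gsrc (boundary_groupoid \<Gamma>) t \<in> cyl \<Gamma> (vpath u)} = {} \<or>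
    (\<exists>x\<in>FP \<Gamma>. {t \<in> rel_T \<Gamma> \<Gamma>' R f. gsrc (boundary_groupoid \<Gamma>) t \<in> cyl \<Gamma> (vpath u)} =
       Zarr \<Gamma> x (vpath (psrc \<Gamma> x)))"
    (is "?A = {} \<or> _")
proof (cases "\<exists>x. (x, epath \<Gamma>' f) \<in> R \<and> psrc \<Gamma> x = u")
  case True
  then obtain x where x: "(x, epath \<Gamma>' f) \<in> R" "psrc \<Gamma> x = u" by blast
  have "?A = Zarr \<Gamma> x (vpath (psrc \<Gamma> x))"
  proof (intro set_eqI, clarify)
    fix a k z
    have unique: "(y, epath \<Gamma>' f) \<in> R \<and> psrc \<Gamma> y = u \<longleftrightarrow> y = x" for y
      using x R_source_inj[OF assms(2)] by metis
    have "(a, k, z) \<in> ?A \<longleftrightarrow> (\<exists>y. ((y, epath \<Gamma>' f) \<in> R \<and> psrc \<Gamma> y = u) \<and> a = bconc y z \<and>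
        k = int (plen y) \<and> z \<in> boundary \<Gamma> \<and> brng \<Gamma> z = u)"
      using assms(1) by (simp add: rel_T_iff boundary_groupoid_def cyl_vpath) metis
    also have "\<dots> \<longleftrightarrow> (a, k, z) \<in> Zarr \<Gamma> x (vpath (psrc \<Gamma> x))"
      unfolding Zarr_vpath_psrc unique using x(2) by simp
    finally show "(a, k, z) \<in> ?A \<longleftrightarrow> (a, k, z) \<in> Zarr \<Gamma> x (vpath (psrc \<Gamma> x))" .
  qed
  then show ?thesis using x R_in_FP by blast
next
  case False
  have "?A = {}"
  proof (rule equals0I)
    fix t assume t: "t \<in> ?A"
    obtain a k z where "t = (a, k, z)" by (cases t)
    with t obtain x where "(x, epath \<Gamma>' f) \<in> R" "brng \<Gamma> z = psrc \<Gamma> x" "brng \<Gamma> z = u"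
      using assms(1) by (auto simp: rel_T_iff boundary_groupoid_def cyl_vpath)
    with False show False by metis
  qed
  then show ?thesis ..
qed

end


theorem theorem5p4:
  fixes \<Gamma>1 :: "('v1, 'e1) pre_digraph"
    and \<Gamma>2 :: "('v2, 'e2) pre_digraph"
    and R :: "(('v1, 'e1) fpath \<times> ('v2, 'e2) fpath) set"
  assumes "wf_digraph \<Gamma>1"
    and "wf_digraph \<Gamma>2"
    and "admissible_relation_morphism \<Gamma>1 \<Gamma>2 R"
  shows "dynamical_CK_family \<Gamma>2 (boundary_groupoid \<Gamma>1) (rel_Omega \<Gamma>1 R) (rel_T \<Gamma>1 \<Gamma>2 R) \<and>
    (nondegenerate_CK_family \<Gamma>2 (boundary_groupoid \<Gamma>1) (rel_Omega \<Gamma>1 R) (rel_T \<Gamma>1 \<Gamma>2 R) \<longleftrightarrow>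
       (\<Union>v\<in>verts \<Gamma>2. Rinv R (vpath v)) = vpath ` verts \<Gamma>1) \<and>
    (\<forall>u\<in>verts \<Gamma>1. \<forall>v\<in>verts \<Gamma>2.
       gset_mult (boundary_groupoid \<Gamma>1)
         (gunit (boundary_groupoid \<Gamma>1) ` cyl \<Gamma>1 (vpath u))
         (gunit (boundary_groupoid \<Gamma>1) ` rel_Omega \<Gamma>1 R v) = {} \<or>
       gset_mult (boundary_groupoid \<Gamma>1)
         (gunit (boundary_groupoid \<Gamma>1) ` cyl \<Gamma>1 (vpath u))
         (gunit (boundary_groupoid \<Gamma>1) ` rel_Omega \<Gamma>1 R v) =
       gunit (boundary_groupoid \<Gamma>1) ` cyl \<Gamma>1 (vpath u)) \<and>
    (\<forall>u\<in>verts \<Gamma>1. \<forall>f\<in>arcs \<Gamma>2.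
       gset_mult (boundary_groupoid \<Gamma>1) (rel_T \<Gamma>1 \<Gamma>2 R f)
         (gunit (boundary_groupoid \<Gamma>1) ` cyl \<Gamma>1 (vpath u)) = {} \<or>
       (\<exists>x\<in>FP \<Gamma>1.
          gset_mult (boundary_groupoid \<Gamma>1) (rel_T \<Gamma>1 \<Gamma>2 R f)
            (gunit (boundary_groupoid \<Gamma>1) ` cyl \<Gamma>1 (vpath u)) =
          Zarr \<Gamma>1 x (vpath (psrc \<Gamma>1 x))))"
proof -
  let ?units = "\<lambda>u v. gset_mult (boundary_groupoid \<Gamma>1)
    (gunit (boundary_groupoid \<Gamma>1) ` cyl \<Gamma>1 (vpath u))
    (gunit (boundary_groupoid \<Gamma>1) ` rel_Omega \<Gamma>1 R v)"
  let ?arrows = "\<lambda>f u. gset_mult (boundary_groupoid \<Gamma>1) (rel_T \<Gamma>1 \<Gamma>2 R f)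
    (gunit (boundary_groupoid \<Gamma>1) ` cyl \<Gamma>1 (vpath u))"
  interpret admissible_morphism \<Gamma>1 \<Gamma>2 R
    using assms by (simp add: admissible_morphism_def admissible_morphism_axioms_def)
  show ?thesis
  proof (intro conjI ballI)
    fix u v assume "u \<in> verts \<Gamma>1" "v \<in> verts \<Gamma>2"
    then show "?units u v = {} \<or> ?units u v = gunit (boundary_groupoid \<Gamma>1) ` cyl \<Gamma>1 (vpath u)"
      unfolding gset_mult_units by (simp add: cyl_vpath_Int_rel_Omega)
  next
    fix u f assume "u \<in> verts \<Gamma>1" "f \<in> arcs \<Gamma>2"
    then show "?arrows f u = {} \<or>
        (\<exists>x\<in>FP \<Gamma>1. ?arrows f u = Zarr \<Gamma>1 x (vpath (psrc \<Gamma>1 x)))"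
      unfolding gset_mult_unit_right by (rule rel_T_restrict)
  qed (rule rel_dynamical_CK_family rel_nondegenerate_iff)+
qed

end
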